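(* Let $u=\vec u+\varepsilon u_0\in\mathbb{DH}[t]$ be a kinematic, minimally saturated plane polynomial with minimal saturating factor $\ell$, and let $h\in\mathbb{R}[t]$. The system of equations $$P\,\mathbf{k}\,P^*=h\,\vec u,\qquad P\,\mathbf{k}\,D^*-D\,\mathbf{k}\,P^*=h\,u_0,\qquad PD^*+DP^*=0$$ for a motion polynomial $C=P+\varepsilon D$ with $P,D\in\mathbb{H}[t]$ has a solution if and only if $h$ is a multiple of $\operatorname{realgcd}(\ell\vec u)/\ell^2$ and $h\ell u$ is still saturated. Solutions of minimal degree are obtained for $h=\operatorname{realgcd}(\ell\vec u)/\ell^2$.
   Context: $\mathbb{H}$ denotes the real quaternions with basis $1,\mathbf{i},\mathbf{j},\mathbf{k}$ and conjugation $q\mapsto q^*$; $\mathbb{DH}=\{p+\varepsilon d: p,d\in\mathbb{H}\}$ denotes the dual quaternions, with $\varepsilon^2=0$ and $\varepsilon$ central; $(p+\varepsilon d)^*=p^*+\varepsilon d^*$, and the norm of a (dual) quaternion $x$ is $N(x)=xx^*$. In $\mathbb{H}[t]$ and $\mathbb{DH}[t]$ the indeterminate $t$ commutes with all coefficients and is unaffected by conjugation. For $w\in\mathbb{DH}[t]$ (or $w\in\mathbb{H}[t]$), $\operatorname{realgcd}(w)\in\mathbb{R}[t]$ is the greatest common divisor of the real coefficient polynomials of $w$ with respect to the standard real basis. A plane polynomial is $u=\vec u+\varepsilon u_0$ with $\vec u=u_1\mathbf{i}+u_2\mathbf{j}+u_3\mathbf{k}$ and $u_0,u_1,u_2,u_3\in\mathbb{R}[t]$.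 It is kinematic if its norm $N(u)=N(\vec u)$ is a square in $\mathbb{R}[t]$. It is saturated if all real zeros of $\operatorname{realgcd}(\vec u)$ are of even multiplicity. It is minimally saturated if there is no polynomial $f\in\mathbb{R}[t]$ of positive degree such that $u/f$ is a saturated polynomial. If $u$ is not saturated, its (minimal) saturating factor is the unique monic polynomial $\ell\in\mathbb{R}[t]$ of minimal degree such that $\ell u$ is saturated; if $u$ is saturated, $\ell=1$. A motion polynomial is $C=P+\varepsilon D\in\mathbb{DH}[t]$ with $P\neq0$ and $PD^*+DP^*=0$; the degree of a solution is the degree of $C$ as a polynomial in $t$. Standing assumption on the given plane polynomial: $\deg u_0=\deg u_1=\deg u_2=\deg u_3$.
   Formalization: In the conditions on h, u is replaced by v=u/realgcd(u) and ℓ is the saturating factor of v, so u=ℓv stays in the system; taken literally (ℓ=1 for saturated u) the claim fails, e.g. for u=t²(4i+2j+4k)+εt(t+1), h=1. The zero polynomial counts as not saturated. *)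

theory Defs
  imports "HOL-Computational_Algebra.Computational_Algebra" "HOL-Computational_Algebra.Field_as_Ring"
begin

section \<open>Quaternions and dual numbers\<close>

text \<open>
  Quaternions over an arbitrary commutative ring. As \<open>t\<close> commutes with every coefficient, the ring
  \<open>H[t]\<close> of quaternionic polynomials is the quaternion algebra over \<open>\<real>[t]\<close>, that is
  \<open>real poly quat\<close>, and \<open>DH[t]\<close> is \<open>real poly quat dual\<close>. The components are the real
  coefficient polynomials with respect to the standard basis. (The multiplication of the library
  type \<open>poly\<close> needs commutative coefficients.)
\<close>

datatype 'a quat = Quat (Qre: 'a) (Qi: 'a) (Qj: 'a) (Qk: 'a)

instantiation quat :: (comm_ring_1) ring_1
begin

definition "0 = Quat 0 0 0 0"
definition "1 = Quat 1 0 0 0"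
definition "x + y = Quat (Qre x + Qre y) (Qi x + Qi y) (Qj x + Qj y) (Qk x + Qk y)"
definition "- x = Quat (- Qre x) (- Qi x) (- Qj x) (- Qk x)"
definition "x - y = Quat (Qre x - Qre y) (Qi x - Qi y) (Qj x - Qj y) (Qk x - Qk y)"
definition "x * y = Quat
  (Qre x * Qre y - Qi x * Qi y - Qj x * Qj y - Qk x * Qk y)
  (Qre x * Qi y + Qi x * Qre y + Qj x * Qk y - Qk x * Qj y)
  (Qre x * Qj y - Qi x * Qk y + Qj x * Qre y + Qk x * Qi y)
  (Qre x * Qk y + Qi x * Qj y - Qj x * Qi y + Qk x * Qre y)"

instance
  by intro_classes
    (simp_all add: zero_quat_def one_quat_def plus_quat_def uminus_quat_def minus_quat_def
      times_quat_def algebra_simps)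

end

definition qconj :: "'a::comm_ring_1 quat \<Rightarrow> 'a quat"
  where "qconj x = Quat (Qre x) (- Qi x) (- Qj x) (- Qk x)"

definition scalar_quat :: "'a::comm_ring_1 \<Rightarrow> 'a quat"
  where "scalar_quat a = Quat a 0 0 0"

definition quat_k :: "'a::comm_ring_1 quat"
  where "quat_k = Quat 0 0 0 1"

text \<open>\<open>Dual p d\<close> stands for \<open>p + \<epsilon> d\<close>.\<close>

datatype 'a dual = Dual (primal_part: 'a) (dual_part: 'a)

instantiation dual :: (ring_1) ring_1
begin

definition "0 = Dual 0 0"
definition "1 = Dual 1 0"
definition "x + y = Dual (primal_part x + primal_part y) (dual_part x + dual_part y)"
definition "- x = Dual (- primal_part x) (- dual_part x)"
definition "x - y = Dual (primal_part x - primal_part y) (dual_part x - dual_part y)"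
definition "x * y = Dual (primal_part x * primal_part y)
  (primal_part x * dual_part y + dual_part x * primal_part y)"

instance
  by intro_classes
    (simp_all add: zero_dual_def one_dual_def plus_dual_def uminus_dual_def minus_dual_def
      times_dual_def algebra_simps)

end

definition dq_conj :: "'a::comm_ring_1 quat dual \<Rightarrow> 'a quat dual"
  where "dq_conj x = Dual (qconj (primal_part x)) (qconj (dual_part x))"

definition dq_norm :: "'a::comm_ring_1 quat dual \<Rightarrow> 'a quat dual"
  where "dq_norm x = x * dq_conj x"

definition scalar_dq :: "'a::comm_ring_1 \<Rightarrow> 'a quat dual"
  where "scalar_dq a = Dual (scalar_quat a) 0"

type_synonym hpoly = "real poly quat"
type_synonym dhpoly = "real poly quat dual"

definition q_coeffs :: "'a quat \<Rightarrow> 'a set"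
  where "q_coeffs x = {Qre x, Qi x, Qj x, Qk x}"

definition dq_coeffs :: "'a quat dual \<Rightarrow> 'a set"
  where "dq_coeffs x = q_coeffs (primal_part x) \<union> q_coeffs (dual_part x)"

definition realgcd :: "hpoly \<Rightarrow> real poly"
  where "realgcd x = Gcd (q_coeffs x)"

definition dq_realgcd :: "dhpoly \<Rightarrow> real poly"
  where "dq_realgcd x = Gcd (dq_coeffs x)"

definition dq_degree :: "dhpoly \<Rightarrow> nat"
  where "dq_degree x = Max (degree ` dq_coeffs x)"


section \<open>Plane polynomials\<close>

definition plane_polynomial :: "dhpoly \<Rightarrow> bool" where
  "plane_polynomial u \<longleftrightarrow> (\<exists>u0 u1 u2 u3. u = Dual (Quat 0 u1 u2 u3) (scalar_quat u0))"

abbreviation plane_vec :: "dhpoly \<Rightarrow> hpoly"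
  where "plane_vec u \<equiv> primal_part u"

abbreviation plane_scalar :: "dhpoly \<Rightarrow> real poly"
  where "plane_scalar u \<equiv> Qre (dual_part u)"

definition kinematic :: "dhpoly \<Rightarrow> bool" where
  "kinematic u \<longleftrightarrow> plane_polynomial u \<and> (\<exists>s. dq_norm u = scalar_dq (s\<^sup>2))"

text \<open>
  Every real number is a zero of infinite, hence not of even, multiplicity of the zero polynomial;
  the library leaves \<open>order x 0\<close> unspecified.
\<close>

definition saturated :: "dhpoly \<Rightarrow> bool" where
  "saturated u \<longleftrightarrow> plane_polynomial u \<and> realgcd (plane_vec u) \<noteq> 0 \<and>
     (\<forall>x. poly (realgcd (plane_vec u)) x = 0 \<longrightarrow> even (order x (realgcd (plane_vec u))))"

definition minimally_saturated :: "dhpoly \<Rightarrow> bool" where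
  "minimally_saturated u \<longleftrightarrow> saturated u \<and>
     \<not> (\<exists>f w. degree f > 0 \<and> u = scalar_dq f * w \<and> saturated w)"

text \<open>For saturated \<open>u\<close> the only saturating factor in this sense is \<open>1\<close>.\<close>

definition saturating_factor :: "dhpoly \<Rightarrow> real poly \<Rightarrow> bool" where
  "saturating_factor u l \<longleftrightarrow>
     lead_coeff l = 1 \<and> saturated (scalar_dq l * u) \<and>
     (\<forall>m. lead_coeff m = 1 \<and> saturated (scalar_dq m * u) \<longrightarrow> degree l \<le> degree m)"

text \<open>
  As \<open>degree 0 = 0\<close>, constant polynomials \<open>u\<close> with some vanishing components are also admitted.
\<close>

definition equal_degrees :: "dhpoly \<Rightarrow> bool" where
  "equal_degrees u \<longleftrightarrow>
     degree (plane_scalar u) = degree (Qi (plane_vec u)) \<and>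
     degree (Qi (plane_vec u)) = degree (Qj (plane_vec u)) \<and>
     degree (Qj (plane_vec u)) = degree (Qk (plane_vec u))"

text \<open>
  A plane polynomial and its nonzero real polynomial multiples describe the same family of planes.
  The reduced representative \<open>v\<close> has no real polynomial factor of positive degree. A minimally
  saturated \<open>u\<close> is \<open>l v\<close> with \<open>l\<close> the saturating factor of \<open>v\<close> (lemma
  \<open>saturating_factor_reduced\<close>), and this \<open>l\<close> is what is meant by the minimal saturating factor
  that belongs to a minimally saturated polynomial.
\<close>

definition reduced_representative :: "dhpoly \<Rightarrow> dhpoly \<Rightarrow> bool" where
  "reduced_representative u v \<longleftrightarrow> u = scalar_dq (dq_realgcd u) * v"


lemma saturated_iff_order:
  "saturated u \<longleftrightarrow> plane_polynomial u \<and> realgcd (plane_vec u) \<noteq> 0 \<and>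
     (\<forall>x. even (order x (realgcd (plane_vec u))))"
  unfolding saturated_def by (metis even_zero order_root)

lemma realgcd_mult: "realgcd (scalar_quat f * x) = normalize (f * realgcd x)"
proof -
  have "q_coeffs (scalar_quat f * x) = (*) f ` q_coeffs x"
    by (simp add: q_coeffs_def scalar_quat_def times_quat_def)
  then show ?thesis by (simp add: realgcd_def Gcd_mult)
qed

lemma order_normalize [simp]: "order x (normalize p) = order x (p :: real poly)"
proof (cases "p = 0")
  case False
  then show ?thesis
    by (intro antisym dvd_imp_order_le) simp_all
qed simp

lemma saturated_mult:
  assumes "f \<noteq> 0"
  shows "saturated (scalar_dq f * v) \<longleftrightarrow> plane_polynomial v \<and> realgcd (plane_vec v) \<noteq> 0 \<and>
     (\<forall>x. even (order x f + order x (realgcd (plane_vec v))))"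
proof -
  have "plane_polynomial (scalar_dq f * v) \<longleftrightarrow> plane_polynomial v"
    using assms
    by (cases v; cases "primal_part v"; cases "dual_part v")
       (auto simp: plane_polynomial_def scalar_dq_def scalar_quat_def times_dual_def times_quat_def
         zero_quat_def plus_quat_def)
  moreover have "plane_vec (scalar_dq f * v) = scalar_quat f * plane_vec v"
    by (simp add: scalar_dq_def times_dual_def)
  ultimately show ?thesis
    using assms by (auto simp: saturated_iff_order realgcd_mult order_mult)
qed

lemma order_gcd:
  fixes p q :: "real poly"
  assumes "p \<noteq> 0" "q \<noteq> 0"
  shows "order x (gcd p q) = min (order x p) (order x q)"
proof (rule antisym)
  show "order x (gcd p q) \<le> min (order x p) (order x q)"
    using assms by (simp add: dvd_imp_order_le)
  have "[:-x, 1:] ^ min (order x p) (order x q) dvd gcd p q"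
    using assms by (auto intro!: gcd_greatest simp: order_divides)
  then show "min (order x p) (order x q) \<le> order x (gcd p q)"
    using assms by (subst (asm) order_divides) simp
qed

text \<open>
  For minimally saturated \<open>u = dq_realgcd u \<cdot> v\<close>, the factor \<open>dq_realgcd u\<close> is the one and only
  saturating factor of \<open>v\<close>; hence \<open>u\<close> arises from \<open>v\<close> by saturation.
\<close>

lemma saturating_factor_reduced:
  assumes u: "minimally_saturated u" and v: "reduced_representative u v"
  shows "saturating_factor v l \<longleftrightarrow> l = dq_realgcd u"
proof -
  define c where "c = dq_realgcd u"
  have uc: "u = scalar_dq c * v" using v by (simp add: reduced_representative_def c_def)
  have sat: "saturated (scalar_dq c * v)" using u uc by (simp add: minimally_saturated_def)
  have c0: "c \<noteq> 0"
  proof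
    assume "c = 0"
    then have "plane_vec u = scalar_quat 0 * plane_vec u"
      by (simp add: uc scalar_dq_def times_dual_def scalar_quat_def times_quat_def)
    then have "realgcd (plane_vec u) = normalize (0 * realgcd (plane_vec u))"
      by (metis realgcd_mult)
    then show False using sat uc by (simp add: saturated_def)
  qed
  have "unit_factor c = 1"
    using c0 by (simp add: c_def dq_realgcd_def unit_factor_Gcd)
  then have cm: "lead_coeff c = 1"
    by (simp add: unit_factor_poly_def one_pCons)
  have dvd: "c dvd m" if m: "m \<noteq> 0" "saturated (scalar_dq m * v)" for m
  proof -
    define e where "e = gcd c m"
    have e0: "e \<noteq> 0" using c0 by (simp add: e_def)
    have "saturated (scalar_dq e * v)"
      using sat m c0 e0 by (auto simp: saturated_mult e_def order_gcd min_def)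
    moreover obtain f where f: "c = f * e" by (metis dvd_def e_def gcd_dvd1 mult.commute)
    moreover have "u = scalar_dq f * (scalar_dq e * v)"
      by (simp add: uc f scalar_dq_def scalar_quat_def times_dual_def times_quat_def
          zero_quat_def plus_quat_def algebra_simps)
    ultimately have "degree f = 0"
      using u unfolding minimally_saturated_def by (metis neq0_conv)
    moreover have "f \<noteq> 0" using f c0 by auto
    ultimately have "is_unit f" by (simp add: is_unit_iff_degree)
    then have "c dvd e" using f by simp
    then show ?thesis by (simp add: e_def)
  qed
  have min: "saturating_factor v c"
    unfolding saturating_factor_def
  proof (intro conjI allI impI)
    fix m assume "lead_coeff m = 1 \<and> saturated (scalar_dq m * v)"
    moreover from this have "m \<noteq> 0" by auto
    ultimately show "degree c \<le> degree m" using dvd dvd_imp_degree_le by blast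
  qed (use cm sat in auto)
  have "l = c" if l: "saturating_factor v l"
  proof -
    have "l \<noteq> 0" "lead_coeff l = 1" "saturated (scalar_dq l * v)"
      using l by (auto simp: saturating_factor_def)
    moreover have "degree l \<le> degree c"
      using l sat cm by (simp add: saturating_factor_def)
    moreover obtain r where r: "l = c * r" using dvd calculation by blast
    ultimately have "degree r = 0" using c0 by (auto simp: degree_mult_eq)
    then obtain a where "r = [:a:]" by (metis degree_eq_zeroE)
    moreover have "lead_coeff r = 1"
      using r cm \<open>lead_coeff l = 1\<close> by (simp add: lead_coeff_mult)
    ultimately show ?thesis using r by simp
  qed
  then show ?thesis using min by (auto simp: c_def)
qed


section \<open>Motion polynomials and the system of equations\<close>

definition motion_polynomial :: "dhpoly \<Rightarrow> bool" where
  "motion_polynomial C \<longleftrightarrow> primal_part C \<noteq> 0 \<and>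
     primal_part C * qconj (dual_part C) + dual_part C * qconj (primal_part C) = 0"

definition solves_system :: "dhpoly \<Rightarrow> real poly \<Rightarrow> dhpoly \<Rightarrow> bool" where
  "solves_system u h C \<longleftrightarrow> motion_polynomial C \<and>
     (let P = primal_part C; D = dual_part C in
        P * quat_k * qconj P = scalar_quat h * plane_vec u \<and>
        P * quat_k * qconj D - D * quat_k * qconj P = scalar_quat (h * plane_scalar u))"

end

theory Submission
  imports Defs
begin

text \<open>
  Let \<open>g\<close> be the content of \<open>plane_vec u\<close>, so that \<open>l = gcd(g, u\<^sub>0)\<close>. Minimality of the saturation
  makes \<open>l\<close> a product of distinct real linear factors, and saturation then gives \<open>l\<^sup>2 dvd g\<close>.

  For necessity, \<open>P k P\<^sup>*\<close> has no real zeros when \<open>P\<close> is primitive, so the real zeros of its content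
  are of even order in general; the identity
  \<open>(P k P\<^sup>*) D + N(P) D k = - 2 \<langle>P k, D\<rangle> P\<close>, valid for \<open>\<langle>P, D\<rangle> = 0\<close>, yields \<open>g dvd l\<^sup>2 h\<close>.

  For sufficiency, write \<open>plane_vec u = g w\<close>. The primitive vector \<open>w\<close> has square norm, hence
  \<open>w = P k P\<^sup>*\<close> for some \<open>P\<close>: start from \<open>(w + s k) k (w + s k)\<^sup>* = 2 (s + w\<^sub>3) w\<close> with
  \<open>s\<^sup>2 = N(w)\<close> and remove the factors of \<open>2 (s + w\<^sub>3)\<close> one complex root at a time. Then
  \<open>(g / l) P\<close> solves the first equation for \<open>h = g / l\<^sup>2\<close>, and a dual part is found by Bezout and
  division with remainder by \<open>N(P)\<close>, which keeps its degree at most that of \<open>(g / l) P\<close>. The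
  remaining admissible \<open>h\<close> differ by a factor \<open>f\<close> with zeros of even order only, for which
  \<open>f k = q k q\<^sup>*\<close>, and \<open>C q\<close> is a solution.
\<close>

section \<open>Quaternions over a commutative ring\<close>

lemma quat_eq_iff: "x = y \<longleftrightarrow> Qre x = Qre y \<and> Qi x = Qi y \<and> Qj x = Qj y \<and> Qk x = Qk y"
  by (auto intro: quat.expand)

lemma quat_zero_sel [simp]:
  "Qre 0 = 0" "Qi 0 = 0" "Qj 0 = 0" "Qk 0 = 0"
  by (simp_all add: zero_quat_def)

lemma quat_add_sel [simp]:
  "Qre (x + y) = Qre x + Qre y" "Qi (x + y) = Qi x + Qi y"
  "Qj (x + y) = Qj x + Qj y" "Qk (x + y) = Qk x + Qk y"
  by (simp_all add: plus_quat_def)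

lemma quat_diff_sel [simp]:
  "Qre (x - y) = Qre x - Qre y" "Qi (x - y) = Qi x - Qi y"
  "Qj (x - y) = Qj x - Qj y" "Qk (x - y) = Qk x - Qk y"
  by (simp_all add: minus_quat_def)

lemma quat_mult_sel:
  "Qre (x * y) = Qre x * Qre y - Qi x * Qi y - Qj x * Qj y - Qk x * Qk y"
  "Qi (x * y) = Qre x * Qi y + Qi x * Qre y + Qj x * Qk y - Qk x * Qj y"
  "Qj (x * y) = Qre x * Qj y - Qi x * Qk y + Qj x * Qre y + Qk x * Qi y"
  "Qk (x * y) = Qre x * Qk y + Qi x * Qj y - Qj x * Qi y + Qk x * Qre y"
  by (simp_all add: times_quat_def)

lemma scalar_quat_sel [simp]:
  "Qre (scalar_quat a) = a" "Qi (scalar_quat a) = 0"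
  "Qj (scalar_quat a) = 0" "Qk (scalar_quat a) = 0"
  by (simp_all add: scalar_quat_def)

lemma quat_k_sel [simp]:
  "Qre quat_k = 0" "Qi quat_k = 0" "Qj quat_k = 0" "Qk quat_k = 1"
  by (simp_all add: quat_k_def)

lemma qconj_sel [simp]:
  "Qre (qconj x) = Qre x" "Qi (qconj x) = - Qi x"
  "Qj (qconj x) = - Qj x" "Qk (qconj x) = - Qk x"
  by (simp_all add: qconj_def)

lemma scalar_mult_sel [simp]:
  "Qre (scalar_quat a * x) = a * Qre x" "Qi (scalar_quat a * x) = a * Qi x"
  "Qj (scalar_quat a * x) = a * Qj x" "Qk (scalar_quat a * x) = a * Qk x"
  by (simp_all add: quat_mult_sel)

lemma scalar_quat_mult: "scalar_quat (a * b) = scalar_quat a * scalar_quat b"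
  by (simp add: quat_eq_iff)

lemma mult_scalar_quat: "x * scalar_quat a = scalar_quat a * x"
  by (simp add: quat_eq_iff quat_mult_sel algebra_simps)

lemma scalar_quat_left_commute: "x * (scalar_quat a * y) = scalar_quat a * (x * y)"
  by (simp flip: mult.assoc add: mult_scalar_quat)

lemma qconj_scalar [simp]: "qconj (scalar_quat a) = scalar_quat a"
  by (simp add: quat_eq_iff)

lemma qconj_mult: "qconj (x * y) = qconj y * qconj x"
  by (simp add: quat_eq_iff quat_mult_sel algebra_simps)

definition qnorm :: "'a::comm_ring_1 quat \<Rightarrow> 'a"
  where "qnorm x = (Qre x)\<^sup>2 + (Qi x)\<^sup>2 + (Qj x)\<^sup>2 + (Qk x)\<^sup>2"

definition qdot :: "'a::comm_ring_1 quat \<Rightarrow> 'a quat \<Rightarrow> 'a"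
  where "qdot x y = Qre x * Qre y + Qi x * Qi y + Qj x * Qj y + Qk x * Qk y"

text \<open>The left side of the first equation; up to scaling it is the image of k under the
  rotation that belongs to x.\<close>

definition qrot :: "'a::comm_ring_1 quat \<Rightarrow> 'a quat"
  where "qrot x = x * quat_k * qconj x"

lemma mult_qconj: "x * qconj x = scalar_quat (qnorm x)"
  by (simp add: quat_eq_iff quat_mult_sel qnorm_def power2_eq_square algebra_simps)

lemma qnorm_mult: "qnorm (x * y) = qnorm x * qnorm y"
  by (simp add: quat_mult_sel qnorm_def power2_eq_square algebra_simps)

lemma qnorm_qconj [simp]: "qnorm (qconj x) = qnorm x"
  by (simp add: qnorm_def)

lemma qnorm_scalar [simp]: "qnorm (scalar_quat a) = a\<^sup>2"
  by (simp add: qnorm_def)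

lemma qnorm_quat_k [simp]: "qnorm quat_k = 1"
  by (simp add: qnorm_def)

lemma qnorm_qrot: "qnorm (qrot x) = (qnorm x)\<^sup>2"
  by (simp add: qrot_def qnorm_mult power2_eq_square)

lemma qrot_sel:
  "Qre (qrot x) = 0" "Qi (qrot x) = 2 * (Qi x * Qk x + Qre x * Qj x)"
  "Qj (qrot x) = 2 * (Qj x * Qk x - Qre x * Qi x)"
  "Qk (qrot x) = (Qre x)\<^sup>2 - (Qi x)\<^sup>2 - (Qj x)\<^sup>2 + (Qk x)\<^sup>2"
  by (simp_all add: qrot_def quat_mult_sel power2_eq_square algebra_simps)

lemma qrot_scalar_mult: "qrot (scalar_quat a * x) = scalar_quat (a\<^sup>2) * qrot x"
  by (simp add: quat_eq_iff qrot_sel power_mult_distrib algebra_simps power2_eq_square)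

lemma qrot_mult: "qrot (x * y) = x * qrot y * qconj x"
  by (simp add: qrot_def qconj_mult mult.assoc)

lemma qrot_mult_scalar_k:
  assumes "qrot y = scalar_quat f * quat_k"
  shows "qrot (x * y) = scalar_quat f * qrot x"
  by (simp add: qrot_mult assms) (simp add: qrot_def scalar_quat_left_commute mult.assoc)

lemma qdot_eq: "x * qconj y + y * qconj x = scalar_quat (2 * qdot x y)"
  by (simp add: quat_eq_iff quat_mult_sel qdot_def algebra_simps)

lemma qdot_k_eq: "x * quat_k * qconj y - y * quat_k * qconj x = scalar_quat (2 * qdot (x * quat_k) y)"
  by (simp add: quat_eq_iff quat_mult_sel qdot_def algebra_simps)

lemma qdot_mult_right: "qdot (x * z) (y * z) = qnorm z * qdot x y"
  by (simp add: qdot_def quat_mult_sel qnorm_def power2_eq_square algebra_simps)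

lemma qdot_scalar_left: "qdot (scalar_quat a * x) y = a * qdot x y"
  by (simp add: qdot_def algebra_simps)

lemma qdot_eq_Qre: "qdot x y = Qre (qconj x * y)"
  by (simp add: qdot_def quat_mult_sel)

lemma qdot_k_eq_Qk: "qdot (x * quat_k) y = Qk (qconj x * y)"
  by (simp add: qdot_def quat_mult_sel algebra_simps)

lemma qdot_mult_self: "qdot x (y * x) = qnorm x * Qre y"
  by (simp add: qdot_def qnorm_def quat_mult_sel power2_eq_square algebra_simps)

lemma qdot_qrot: "qdot (x * quat_k) (y * x) = qdot (qrot x) y"
  by (simp add: qdot_def qrot_sel quat_mult_sel power2_eq_square algebra_simps)

text \<open>With x' for the conjugate of x, orthogonality means x' y = - y' x, so the sum equals (y
  k x' - x k y') x, and the bracket is scalar.\<close>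

lemma qrot_mult_qnorm_mult:
  assumes "qdot x y = 0"
  shows "qrot x * y + scalar_quat (qnorm x) * (y * quat_k) = scalar_quat (- 2 * qdot (x * quat_k) y) * x"
proof -
  have "qrot x * y + scalar_quat (qnorm x) * (y * quat_k) =
      scalar_quat (- 2 * qdot (x * quat_k) y) * x + scalar_quat (2 * qdot x y) * (x * quat_k)"
    unfolding quat_eq_iff
    by (simp add: quat_mult_sel qrot_sel qdot_def qnorm_def power2_eq_square algebra_simps)
  then show ?thesis using assms by (simp add: quat_eq_iff)
qed


section \<open>Quaternionic polynomials\<close>

lemma dvd_realgcd_iff: "f dvd realgcd x \<longleftrightarrow> f dvd Qre x \<and> f dvd Qi x \<and> f dvd Qj x \<and> f dvd Qk x"
  by (auto simp: realgcd_def q_coeffs_def)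

lemma realgcd_eq_0_iff [simp]: "realgcd x = 0 \<longleftrightarrow> x = 0"
  by (auto simp: realgcd_def q_coeffs_def quat_eq_iff)

lemma realgcd_0 [simp]: "realgcd 0 = 0"
  by simp

lemma normalize_realgcd [simp]: "normalize (realgcd x) = realgcd x"
  by (simp add: realgcd_def)

lemma dvd_realgcd_factor:
  assumes "f dvd realgcd x"
  obtains y where "x = scalar_quat f * y"
proof
  show "x = scalar_quat f * Quat (Qre x div f) (Qi x div f) (Qj x div f) (Qk x div f)"
    using assms by (simp add: quat_eq_iff dvd_realgcd_iff)
qed

lemma realgcd_factor:
  assumes "x \<noteq> 0"
  obtains y where "x = scalar_quat (realgcd x) * y" "realgcd y = 1"
proof -
  obtain y where y: "x = scalar_quat (realgcd x) * y"
    using dvd_realgcd_factor[of "realgcd x" x] by auto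
  then have "realgcd x = normalize (realgcd x * realgcd y)" by (metis realgcd_mult)
  then have "realgcd x = realgcd x * realgcd y" by (simp add: normalize_mult)
  with assms y that show ?thesis by simp
qed

lemma scalar_quat_mult_cancel:
  fixes f :: "real poly"
  assumes "f \<noteq> 0"
  shows "scalar_quat f * x = scalar_quat f * y \<longleftrightarrow> x = y"
  using assms by (simp add: quat_eq_iff)

lemma qnorm_eq_0_iff [simp]:
  fixes x :: "'a::linordered_idom quat"
  shows "qnorm x = 0 \<longleftrightarrow> x = 0"
  by (auto simp: qnorm_def quat_eq_iff add_nonneg_eq_0_iff)

lemma qrot_eq_0_iff [simp]:
  fixes x :: "'a::linordered_idom quat"
  shows "qrot x = 0 \<longleftrightarrow> x = 0"
  by (metis qnorm_eq_0_iff qnorm_qrot zero_eq_power2)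

lemma power2_dvd_qnorm:
  assumes "f dvd realgcd x"
  shows "f\<^sup>2 dvd qnorm x"
  using assms by (simp add: dvd_realgcd_iff qnorm_def)

text \<open>The norm of \<open>qrot x\<close> is the square of \<open>qnorm x\<close>, so the square
  of the content divides a square, and the roots inherit divisibility.\<close>

lemma realgcd_qrot_dvd_qnorm: "realgcd (qrot x) dvd qnorm x"
  using power2_dvd_qnorm[of "realgcd (qrot x)" "qrot x"] by (simp add: qnorm_qrot)

section \<open>Degrees of quaternionic polynomials\<close>

definition qdeg :: "hpoly \<Rightarrow> nat"
  where "qdeg x = Max (degree ` q_coeffs x)"

lemma qdeg_le_iff:
  "qdeg x \<le> d \<longleftrightarrow>
    degree (Qre x) \<le> d \<and> degree (Qi x) \<le> d \<and> degree (Qj x) \<le> d \<and> degree (Qk x) \<le> d"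
  by (auto simp: qdeg_def q_coeffs_def)

lemma dq_degree_eq: "dq_degree C = max (qdeg (primal_part C)) (qdeg (dual_part C))"
  unfolding dq_degree_def qdeg_def dq_coeffs_def image_Un
  by (rule Max_Un) (auto simp: q_coeffs_def)

text \<open>Leading terms cannot cancel: the coefficient of the norm at twice the maximal degree is
  a sum of real squares.\<close>

lemma degree_qnorm: "degree (qnorm x) = 2 * qdeg x"
proof (rule antisym)
  define m where "m = qdeg x"
  have m: "degree (Qre x) \<le> m" "degree (Qi x) \<le> m" "degree (Qj x) \<le> m" "degree (Qk x) \<le> m"
    using qdeg_le_iff[of x m] by (simp_all add: m_def)
  have deg: "degree (p\<^sup>2) \<le> 2 * m" if "degree p \<le> m" for p :: "real poly"
    using that degree_power_le[of p 2] by simp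
  show "degree (qnorm x) \<le> 2 * qdeg x"
    unfolding qnorm_def m_def[symmetric] using m by (intro degree_add_le deg) auto
  have sq: "coeff (p\<^sup>2) (2 * m) = (coeff p m)\<^sup>2" if "degree p \<le> m" for p :: "real poly"
    using coeff_mult_degree_sum[of p p] that coeff_eq_0[of p m] coeff_eq_0[of "p\<^sup>2" "2 * m"]
      degree_power_le[of p 2]
    by (cases "degree p = m") (auto simp: power2_eq_square mult_2)
  show "2 * qdeg x \<le> degree (qnorm x)"
  proof (rule ccontr)
    assume L: "\<not> ?thesis"
    then have "coeff (qnorm x) (2 * m) = 0" by (intro coeff_eq_0) (simp add: m_def)
    then have "(coeff (Qre x) m)\<^sup>2 + (coeff (Qi x) m)\<^sup>2 + (coeff (Qj x) m)\<^sup>2 + (coeff (Qk x) m)\<^sup>2 = 0"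
      using m by (simp add: qnorm_def sq)
    then have "coeff (Qre x) m = 0 \<and> coeff (Qi x) m = 0 \<and> coeff (Qj x) m = 0 \<and> coeff (Qk x) m = 0"
      by (simp add: add_nonneg_eq_0_iff)
    moreover have "m \<in> {degree (Qre x), degree (Qi x), degree (Qj x), degree (Qk x)}"
      using Max_in[of "degree ` q_coeffs x"] by (simp add: m_def qdeg_def q_coeffs_def)
    \<comment> \<open>For \<open>m > 0\<close> a component of degree m is nonzero, as
      \<open>degree 0 = 0\<close>, yet its leading coefficient would vanish.\<close>
    moreover have "0 < m" using L by (simp add: m_def)
    ultimately show False by (metis insert_iff empty_iff leading_coeff_0_iff degree_0 less_irrefl)
  qed
qed

lemma qdeg_mult:
  assumes "x \<noteq> 0" "y \<noteq> 0"
  shows "qdeg (x * y) = qdeg x + qdeg y"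
  using degree_qnorm[of "x * y"] degree_qnorm[of x] degree_qnorm[of y] assms
  by (simp add: qnorm_mult degree_mult_eq)

lemma qdeg_qconj [simp]: "qdeg (qconj x) = qdeg x"
  using degree_qnorm[of x] degree_qnorm[of "qconj x"] by simp

lemma qdeg_scalar [simp]: "qdeg (scalar_quat f) = degree f"
  by (simp add: qdeg_def q_coeffs_def)

lemma qdeg_scalar_mult:
  assumes "f \<noteq> 0" "x \<noteq> 0"
  shows "qdeg (scalar_quat f * x) = degree f + qdeg x"
proof -
  have "scalar_quat f \<noteq> 0" using assms by (simp add: quat_eq_iff)
  then show ?thesis using assms by (simp add: qdeg_mult)
qed

lemma qdeg_qrot: "qdeg (qrot x) = 2 * qdeg x"
proof -
  have "degree (qnorm (qrot x)) = 2 * degree (qnorm x)"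
    by (cases "qnorm x = 0") (simp_all add: qnorm_qrot degree_power_eq del: qnorm_eq_0_iff)
  then show ?thesis by (simp add: degree_qnorm)
qed

text \<open>A real zero of the content is a zero of the norm, and a sum of four real squares
  vanishes only with each of them.\<close>

lemma poly_realgcd_qrot:
  assumes "realgcd x = 1"
  shows "poly (realgcd (qrot x)) a \<noteq> 0"
proof
  assume "poly (realgcd (qrot x)) a = 0"
  then have "poly (qnorm x) a = 0"
    using realgcd_qrot_dvd_qnorm by (metis dvdE mult_zero_left poly_mult)
  then have "poly (Qre x) a = 0 \<and> poly (Qi x) a = 0 \<and> poly (Qj x) a = 0 \<and> poly (Qk x) a = 0"
    by (simp add: qnorm_def add_nonneg_eq_0_iff)
  then have "[:- a, 1:] dvd realgcd x" by (simp add: dvd_realgcd_iff poly_eq_0_iff_dvd)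
  then show False using assms by (simp add: poly_eq_0_iff_dvd[symmetric])
qed


section \<open>Complex roots of real polynomials\<close>

definition cpoly :: "real poly \<Rightarrow> complex \<Rightarrow> complex"
  where "cpoly p = poly (map_poly of_real p)"

lemma cpoly_simps [simp]:
  "cpoly 0 z = 0" "cpoly 1 z = 1" "cpoly (pCons a p) z = of_real a + z * cpoly p z"
  by (simp_all add: cpoly_def map_poly_pCons)

lemma cpoly_add [simp]: "cpoly (p + q) z = cpoly p z + cpoly q z"
  by (induction p q rule: poly_induct2) (simp_all add: algebra_simps)

lemma cpoly_smult [simp]: "cpoly (smult a p) z = of_real a * cpoly p z"
  by (induction p) (simp_all add: algebra_simps)

lemma cpoly_diff [simp]: "cpoly (p - q) z = cpoly p z - cpoly q z"
  using cpoly_add[of p "smult (- 1) q"] cpoly_smult[of "-1" q z] by simp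

lemma cpoly_mult [simp]: "cpoly (p * q) z = cpoly p z * cpoly q z"
  by (induction p) (simp_all add: algebra_simps)

lemma cpoly_of_real: "cpoly p (of_real x) = of_real (poly p x)"
  by (induction p) simp_all

lemma cpoly_root_exists:
  assumes "degree p > 0"
  shows "\<exists>z. cpoly p z = 0"
proof -
  have "degree (map_poly complex_of_real p) > 0"
    using assms by (simp add: degree_map_poly)
  then have "\<not> constant (poly (map_poly complex_of_real p))"
    by (simp add: constant_degree)
  then show ?thesis
    unfolding cpoly_def by (rule fundamental_theorem_of_algebra)
qed

text \<open>For non-real z this is the minimal polynomial of z over the reals.\<close>

definition cquad :: "complex \<Rightarrow> real poly"
  where "cquad z = [:(Re z)\<^sup>2 + (Im z)\<^sup>2, - 2 * Re z, 1:]"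

lemma degree_cquad [simp]: "degree (cquad z) = 2"
  by (simp add: cquad_def)

lemma cquad_neq_0 [simp]: "cquad z \<noteq> 0"
  by (simp add: cquad_def)

lemma cpoly_cquad [simp]: "cpoly (cquad z) z = 0"
  by (simp add: cquad_def complex_eq_iff power2_eq_square algebra_simps)

lemma cquad_no_real_root:
  assumes "Im z \<noteq> 0"
  shows "poly (cquad z) x \<noteq> 0"
proof -
  have "poly (cquad z) x = (x - Re z)\<^sup>2 + (Im z)\<^sup>2"
    by (simp add: cquad_def power2_eq_square algebra_simps)
  then show ?thesis using assms by (simp add: add_nonneg_eq_0_iff)
qed

lemma order_cquad [simp]: "Im z \<noteq> 0 \<Longrightarrow> order x (cquad z) = 0"
  using cquad_no_real_root order_root by blast

text \<open>The remainder modulo \<open>cquad z\<close> has degree at most 1 and vanishes at a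
  non-real z only if it is zero.\<close>

lemma cquad_dvd_iff:
  assumes "Im z \<noteq> 0"
  shows "cquad z dvd p \<longleftrightarrow> cpoly p z = 0"
proof
  assume z: "cpoly p z = 0"
  define r where "r = p mod cquad z"
  have "p = cquad z * (p div cquad z) + r" by (simp add: r_def)
  then have "cpoly p z = cpoly r z" by (metis cpoly_add cpoly_mult cpoly_cquad mult_zero_left add_0)
  with z have "cpoly r z = 0" by simp
  moreover have "degree r < 2"
    using degree_mod_less[of "cquad z" p] by (auto simp: r_def)
  then obtain a b where r: "r = [:a, b:]"
    by (metis degree_eq_zeroE less_2_cases_iff degree1_coeffs pCons_0_0 One_nat_def)
  ultimately have "r = 0" using assms by (auto simp: complex_eq_iff)
  then show "cquad z dvd p" by (auto simp: r_def)
qed auto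

lemma real_poly_factor_cases:
  assumes "degree p > 0"
  obtains x where "[:- x, 1:] dvd p" | z where "Im z \<noteq> 0" "cquad z dvd p"
proof -
  obtain z where z: "cpoly p z = 0" using cpoly_root_exists assms by blast
  show ?thesis
  proof (cases "Im z = 0")
    case True
    then have "z = of_real (Re z)" by (simp add: complex_eq_iff)
    then have "poly p (Re z) = 0" using z by (metis cpoly_of_real of_real_eq_0_iff)
    then show ?thesis using that by (simp add: poly_eq_0_iff_dvd)
  next
    case False
    then show ?thesis using that z by (simp add: cquad_dvd_iff)
  qed
qed

text \<open>Solvability is multiplicative in f, so it suffices to treat constants, squares of linear
  factors and quadratics without real zeros.\<close>

lemma even_order_qrot:
  fixes f :: "real poly"
  assumes "f \<noteq> 0" "\<And>x. even (order x f)"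
  shows "\<exists>q. qrot q = scalar_quat f * quat_k"
  using assms
proof (induction "degree f" arbitrary: f rule: less_induct)
  case less
  have step: ?case
    if g: "g \<noteq> 0" "degree g > 0" "\<And>x. even (order x g)" "g dvd f" "qrot p = scalar_quat g * quat_k" for g p
  proof -
    obtain e where e: "f = g * e" using g(4) by blast
    with less.prems have "e \<noteq> 0" by auto
    moreover have "degree e < degree f" using e g \<open>e \<noteq> 0\<close> by (simp add: degree_mult_eq)
    moreover have "even (order x e)" for x
      using less.prems(2)[of x] g(3)[of x] g(1) e \<open>e \<noteq> 0\<close> by (simp add: order_mult)
    ultimately obtain q where q: "qrot q = scalar_quat e * quat_k" using less.hyps by blast
    have "qrot (p * q) = scalar_quat f * quat_k"
      using qrot_mult_scalar_k[OF q, of p] g(5) by (simp add: quat_eq_iff e)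
    then show ?case by blast
  qed
  show ?case
  proof (cases "degree f = 0")
    case True
    then obtain c where c: "f = [:c:]" by (metis degree_eq_zeroE)
    \<comment> \<open>Conjugation by i sends k to -k, which covers negative constants.\<close>
    define q where "q = (if c > 0 then Quat [:sqrt c:] 0 0 0 else Quat 0 [:sqrt (- c):] 0 0)"
    have "qrot q = scalar_quat f * quat_k"
      by (auto simp: quat_eq_iff qrot_sel q_def c power2_eq_square)
    then show ?thesis by blast
  next
    case False
    then have "degree f > 0" by simp
    then show ?thesis
    proof (cases rule: real_poly_factor_cases)
      case (1 a)
      then have "order a f > 0" using less.prems(1) by (metis order_gt_0_iff poly_eq_0_iff_dvd)
      then have "2 \<le> order a f" using less.prems(2)[of a] by (metis dvd_imp_le)
      then have "[:- a, 1:]\<^sup>2 dvd f" using order_divides by blast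
      moreover have "order x ([:- a, 1:]\<^sup>2) = order x [:- a, 1:] + order x [:- a, 1:]" for x
        unfolding power2_eq_square by (rule order_mult) simp
      moreover have "qrot (scalar_quat [:- a, 1:]) = scalar_quat ([:- a, 1:]\<^sup>2) * quat_k"
        by (simp add: quat_eq_iff qrot_sel)
      ultimately show ?thesis
        by (intro step[of "[:- a, 1:]\<^sup>2" "scalar_quat [:- a, 1:]"])
           (simp_all add: degree_power_eq del: power_Suc)
    next
      case (2 z)
      \<comment> \<open>This lies in the span of 1 and k, hence commutes with k, and its norm is
        \<open>cquad z\<close>.\<close>
      let ?q = "scalar_quat [:- Re z, 1:] + scalar_quat [:Im z:] * quat_k"
      have "qrot ?q = scalar_quat (cquad z) * quat_k"
        by (simp add: quat_eq_iff qrot_sel cquad_def power2_eq_square algebra_simps)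
      then show ?thesis using 2 by (intro step[of "cquad z" ?q]) auto
    qed
  qed
qed


section \<open>Quaternionic square roots of primitive vectors\<close>

text \<open>A real factor f of P enters \<open>qrot P\<close> as a square. As w is primitive, the
  content of the right side is F up to a unit, so the square can be cancelled from F.\<close>

lemma qrot_descent_real:
  assumes P: "qrot P = scalar_quat F * w" and w: "realgcd w = 1"
    and f: "f dvd realgcd P" "degree f > 0" and F: "F \<noteq> 0"
  shows "\<exists>F' P'. degree F' < degree F \<and> F' \<noteq> 0 \<and> qrot P' = scalar_quat F' * w"
proof -
  obtain R where R: "P = scalar_quat f * R" using f dvd_realgcd_factor by blast
  have eq: "scalar_quat F * w = scalar_quat (f\<^sup>2) * qrot R" using P R qrot_scalar_mult by metis
  then have "normalize (F * realgcd w) = normalize (f\<^sup>2 * realgcd (qrot R))" by (metis realgcd_mult)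
  then have "normalize F = normalize (f\<^sup>2 * realgcd (qrot R))" using w by simp
  then have "f\<^sup>2 dvd F" by (metis dvd_normalize_iff dvd_triv_left)
  then obtain F' where F': "F = f\<^sup>2 * F'" by blast
  have "f\<^sup>2 \<noteq> 0" "F' \<noteq> 0" using F F' by auto
  moreover have "degree F' < degree F"
    using F F' f by (auto simp: degree_mult_eq power2_eq_square)
  moreover have "qrot R = scalar_quat F' * w"
    using eq \<open>f\<^sup>2 \<noteq> 0\<close> by (simp add: F' scalar_quat_mult mult.assoc scalar_quat_mult_cancel)
  ultimately show ?thesis by blast
qed

text \<open>The numbers are the components of a quaternion x = w + a i + b j + c k with complex
  coefficients, and the conclusion says that x k is e times the complex unit times x. Each pair
  fixes a sign; a mixed equation makes the signs compatible unless one pair is zero.\<close>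

lemma complex_isotropic_sign:
  fixes w a b c :: complex
  assumes "w\<^sup>2 + c\<^sup>2 = 0" "a\<^sup>2 + b\<^sup>2 = 0" "a * c + w * b = 0" "b * c - w * a = 0"
  obtains e :: complex where "e = 1 \<or> e = -1"
    "- c = e * \<i> * w" "b = e * \<i> * a" "- a = e * \<i> * b" "w = e * \<i> * c"
proof -
  have "(c - \<i> * w) * (c + \<i> * w) = 0" "(b - \<i> * a) * (b + \<i> * a) = 0"
    using assms by (simp_all add: algebra_simps power2_eq_square)
  then have c: "c = \<i> * w \<or> c = - (\<i> * w)" and b: "b = \<i> * a \<or> b = - (\<i> * a)"
    by (auto simp: eq_neg_iff_add_eq_0)
  have "(c = - (\<i> * w) \<and> b = \<i> * a) \<or> (c = \<i> * w \<and> b = - (\<i> * a))"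
  proof (rule ccontr)
    assume neg: "\<not> ?thesis"
    with b c have "(c = \<i> * w \<and> b = \<i> * a) \<or> (c = - (\<i> * w) \<and> b = - (\<i> * a))" by blast
    then have "2 * \<i> * a * w = 0"
    proof
      assume "c = \<i> * w \<and> b = \<i> * a"
      with assms(3) show ?thesis by (simp add: algebra_simps)
    next
      assume "c = - (\<i> * w) \<and> b = - (\<i> * a)"
      with assms(3) show ?thesis by (simp add: algebra_simps)
    qed
    then have "a = 0 \<or> w = 0" by simp
    with neg b c show False by force
  qed
  then show ?thesis
  proof
    assume "c = - (\<i> * w) \<and> b = \<i> * a"
    then show ?thesis by (intro that[of 1]) simp_all
  next
    assume "c = \<i> * w \<and> b = - (\<i> * a)"
    then show ?thesis by (intro that[of "- 1"]) simp_all
  qed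
qed

text \<open>
  At a non-real root \<open>z\<close> of \<open>F\<close> the isotropic quaternion \<open>P(z)\<close> satisfies \<open>P(z) k = \<plusminus>\<i> P(z)\<close>. With
  \<open>\<lambda> = (t - Re z) / Im z\<close>, which takes the value \<open>\<i>\<close> at \<open>z\<close>, the product \<open>P (\<plusminus>\<lambda> - k)\<close> is therefore
  divisible by \<open>cquad z\<close>, while \<open>\<plusminus>\<lambda> - k\<close> only contributes one such factor to the norm.
\<close>
lemma qrot_descent_complex:
  assumes P: "qrot P = scalar_quat F * w"
    and z: "cquad z dvd F" "Im z \<noteq> 0" and F: "F \<noteq> 0"
  shows "\<exists>F' P'. degree F' < degree F \<and> F' \<noteq> 0 \<and> qrot P' = scalar_quat F' * w"
proof -
  let ?c = "\<lambda>p. cpoly p z"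
  obtain G where G: "F = cquad z * G" using z by blast
  have F0: "?c F = 0" by (simp add: G)
  have "cquad z dvd realgcd (qrot P)"
    using z by (auto simp: P dvd_realgcd_iff)
  then have N: "cquad z dvd qnorm P" using realgcd_qrot_dvd_qnorm dvd_trans by blast
  have rot0: "?c (Qi (qrot P)) = 0" "?c (Qj (qrot P)) = 0" "?c (Qk (qrot P)) = 0"
    using F0 by (simp_all add: P)
  have "?c (qnorm P) = 0" using N z by (simp add: cquad_dvd_iff)
  \<comment> \<open>The k-component of \<open>qrot P\<close> and the norm are the difference and the
    sum of the same two sums of squares.\<close>
  with rot0 have iso: "(?c (Qre P))\<^sup>2 + (?c (Qk P))\<^sup>2 = 0" "(?c (Qi P))\<^sup>2 + (?c (Qj P))\<^sup>2 = 0"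
      "?c (Qi P) * ?c (Qk P) + ?c (Qre P) * ?c (Qj P) = 0"
      "?c (Qj P) * ?c (Qk P) - ?c (Qre P) * ?c (Qi P) = 0"
    unfolding qrot_sel qnorm_def by (simp_all add: power2_eq_square numeral_poly algebra_simps)
       algebra+
  obtain e where e: "e = 1 \<or> e = -1" and eqs:
    "- ?c (Qk P) = e * \<i> * ?c (Qre P)" "?c (Qj P) = e * \<i> * ?c (Qi P)"
    "- ?c (Qi P) = e * \<i> * ?c (Qj P)" "?c (Qre P) = e * \<i> * ?c (Qk P)"
    using complex_isotropic_sign[OF iso] by blast
  obtain \<epsilon> :: real where \<epsilon>: "e = of_real \<epsilon>" "\<epsilon>\<^sup>2 = 1" using e by (auto intro: that[of 1] that[of "-1"])
  define L where "L = smult (\<epsilon> / Im z) [:- Re z, 1:]"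
  have cL: "?c L = e * \<i>"
    using z by (simp add: L_def \<epsilon> complex_eq_iff)
  define q where "q = scalar_quat L - quat_k"
  have "cquad z dvd realgcd (P * q)"
    using z eqs by (simp add: dvd_realgcd_iff cquad_dvd_iff q_def quat_mult_sel cL algebra_simps)
  then obtain R where R: "P * q = scalar_quat (cquad z) * R" using dvd_realgcd_factor by blast
  have L2: "L\<^sup>2 + 1 = smult (1 / (Im z)\<^sup>2) (cquad z)"
    using z \<epsilon>(2) by (simp add: L_def cquad_def power2_eq_square one_pCons field_simps)
  have "qrot q = scalar_quat (smult (1 / (Im z)\<^sup>2) (cquad z)) * quat_k"
    by (simp add: quat_eq_iff qrot_sel q_def flip: L2)
  then have "qrot (P * q) = scalar_quat (smult (1 / (Im z)\<^sup>2) (cquad z)) * (scalar_quat F * w)"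
    by (simp add: qrot_mult_scalar_k P)
  \<comment> \<open>On the right one factor \<open>cquad z\<close> comes from q and the other from
    F.\<close>
  then have "scalar_quat ((cquad z)\<^sup>2) * qrot R = 
      scalar_quat ((cquad z)\<^sup>2) * (scalar_quat (smult (1 / (Im z)\<^sup>2) G) * w)"
    by (simp add: R qrot_scalar_mult G quat_eq_iff power2_eq_square mult.assoc)
  then have "qrot R = scalar_quat (smult (1 / (Im z)\<^sup>2) G) * w"
    by (simp add: scalar_quat_mult_cancel)
  moreover have "G \<noteq> 0" "degree G < degree F" using F G by (auto simp: degree_mult_eq)
  ultimately show ?thesis using z by (intro exI[of _ "smult (1 / (Im z)\<^sup>2) G"] exI[of _ R]) auto
qed

text \<open>At a real zero of F the primitive part of P contributes nothing to the content of
  \<open>qrot P\<close>, so the zero lies in the content of P; at a non-real zero a right factor is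
  used.\<close>

lemma qrot_descent:
  assumes P: "qrot P = scalar_quat F * w" and w: "realgcd w = 1" and F: "F \<noteq> 0" "degree F > 0"
  shows "\<exists>F' P'. degree F' < degree F \<and> F' \<noteq> 0 \<and> qrot P' = scalar_quat F' * w"
  using F(2)
proof (cases rule: real_poly_factor_cases)
  case (1 a)
  then have "[:- a, 1:] dvd realgcd (qrot P)" by (simp add: P dvd_realgcd_iff)
  then have a0: "poly (realgcd (qrot P)) a = 0" by (simp add: poly_eq_0_iff_dvd)
  have "P \<noteq> 0" 
    using P F w by (metis qrot_eq_0_iff realgcd_eq_0_iff scalar_quat_mult_cancel mult_zero_right zero_neq_one)
  then obtain R where R: "P = scalar_quat (realgcd P) * R" "realgcd R = 1" using realgcd_factor by blast
  have "realgcd (qrot P) = normalize ((realgcd P)\<^sup>2 * realgcd (qrot R))"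
    by (metis R(1) qrot_scalar_mult realgcd_mult)
  then have "[:- a, 1:] dvd (realgcd P)\<^sup>2 * realgcd (qrot R)"
    using a0 by (metis dvd_normalize_iff poly_eq_0_iff_dvd)
  then have "poly (realgcd P) a = 0"
    using poly_realgcd_qrot[OF R(2), of a] by (simp flip: poly_eq_0_iff_dvd)
  then have "[:- a, 1:] dvd realgcd P" by (simp add: poly_eq_0_iff_dvd)
  from qrot_descent_real[OF P w this _ F(1)] show ?thesis by simp
next
  case (2 z)
  then show ?thesis using qrot_descent_complex[OF P _ _ F(1)] by blast
qed

text \<open>As s k has the length of w, the vector w + s k bisects the two and turns k into a
  multiple of w. The descent reduces the multiplier to a nonzero constant, which a right factor
  absorbs.\<close>

lemma primitive_vector_eq_qrot:
  assumes w: "realgcd w = 1" "Qre w = 0" and s: "qnorm w = s\<^sup>2"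
  shows "\<exists>P. qrot P = w"
proof -
  have rot: "qrot (w + scalar_quat r * quat_k) = scalar_quat (2 * (r + Qk w)) * w" if "r\<^sup>2 = s\<^sup>2" for r
  proof -
    have r: "r * r = Qi w * Qi w + Qj w * Qj w + Qk w * Qk w"
      using that s w(2) by (simp add: qnorm_def power2_eq_square)
    show ?thesis using w(2)
      by (simp add: quat_eq_iff qrot_sel power2_eq_square algebra_simps r)
  qed
  have "\<exists>F P. F \<noteq> 0 \<and> qrot P = scalar_quat F * w"
  proof (cases "s + Qk w = 0")
    case False
    then show ?thesis using rot[of s] by (intro exI[of _ "2 * (s + Qk w)"]) auto
  next
    case True
    \<comment> \<open>Both signs of s fail only for s = 0, which forces w = 0.\<close>
    have "- s + Qk w \<noteq> 0"
    proof
      assume "- s + Qk w = 0"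
      with True have "s = 0" by (simp add: add_eq_0_iff2)
      then have "qnorm w = 0" using s by simp
      then have "w = 0" by (simp only: qnorm_eq_0_iff)
      then have "realgcd w = 0" by (simp only: realgcd_eq_0_iff)
      then show False using w(1) by (simp only: zero_neq_one)
    qed
    then show ?thesis using rot[of "- s"] by (intro exI[of _ "2 * (- s + Qk w)"]) auto
  qed
  then obtain F P where "F \<noteq> 0" "qrot P = scalar_quat F * w" by blast
  then have "\<exists>F P. degree F = 0 \<and> F \<noteq> 0 \<and> qrot P = scalar_quat F * w"
  proof (induction "degree F" arbitrary: F P rule: less_induct)
    case less
    show ?case
    proof (cases "degree F = 0")
      case True
      then show ?thesis using less.prems by blast
    next
      case False
      then obtain F' P' where "degree F' < degree F" "F' \<noteq> 0" "qrot P' = scalar_quat F' * w"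
        using qrot_descent[OF less.prems(2) w(1) less.prems(1)] by blast
      then show ?thesis by (rule less.hyps)
    qed
  qed
  then obtain a P where a: "a \<noteq> 0" and P: "qrot P = scalar_quat [:a:] * w"
    by (metis degree_eq_zeroE pCons_0_0)
  obtain q where "qrot q = scalar_quat [:1 / a:] * quat_k"
    using even_order_qrot[of "[:1 / a:]"] a by (auto simp: order_0I)
  then have "qrot (P * q) = scalar_quat [:1 / a:] * (scalar_quat [:a:] * w)"
    by (simp add: qrot_mult_scalar_k P)
  also have "\<dots> = w" using a by (simp add: quat_eq_iff)
  finally show ?thesis by blast
qed


section \<open>The system of equations\<close>

text \<open>The last two equations have scalar left sides, so each amounts to one polynomial
  equation for an inner product.\<close>

lemma solves_system_iff:
  "solves_system u h C \<longleftrightarrow> primal_part C \<noteq> 0 \<and> qdot (primal_part C) (dual_part C) = 0 \<and>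
     qrot (primal_part C) = scalar_quat h * plane_vec u \<and>
     2 * qdot (primal_part C * quat_k) (dual_part C) = h * plane_scalar u"
  unfolding solves_system_def motion_polynomial_def Let_def qdot_eq qdot_k_eq qrot_def
  by (auto simp: quat_eq_iff)

text \<open>Right multiplication of x and y by q multiplies x k y' by f, where y' is the conjugate
  of y, and the inner product of x and y by \<open>qnorm q\<close>.\<close>

lemma solves_system_mult:
  assumes "solves_system u h C" and q: "qrot q = scalar_quat f * quat_k" and f: "f \<noteq> 0"
  shows "\<exists>C. solves_system u (h * f) C"
proof -
  obtain P D where C: "C = Dual P D" by (cases C)
  have PD: "P \<noteq> 0" "qdot P D = 0" "qrot P = scalar_quat h * plane_vec u"
      "P * quat_k * qconj D - D * quat_k * qconj P = scalar_quat (h * plane_scalar u)"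
    using assms(1) by (auto simp: solves_system_iff C qdot_k_eq)
  have q': "q * quat_k * qconj q = scalar_quat f * quat_k" using q by (simp add: qrot_def)
  have tr: "(x * q) * quat_k * qconj (y * q) = scalar_quat f * (x * quat_k * qconj y)" for x y
  proof -
    have "(x * q) * quat_k * qconj (y * q) = x * (q * quat_k * qconj q) * qconj y"
      by (simp add: qconj_mult mult.assoc)
    also have "\<dots> = scalar_quat f * (x * quat_k * qconj y)"
      unfolding q' by (simp add: scalar_quat_left_commute mult.assoc)
    finally show ?thesis .
  qed
  have "q \<noteq> 0" using q f by (auto simp: quat_eq_iff qrot_sel)
  then have "qnorm (P * q) \<noteq> 0" using PD(1) by (simp add: qnorm_mult)
  then have "P * q \<noteq> 0" by auto
  moreover have "qdot (P * q) (D * q) = 0" by (simp add: qdot_mult_right PD)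
  moreover have "qrot (P * q) = scalar_quat (h * f) * plane_vec u"
    by (simp add: qrot_mult_scalar_k[OF q] PD quat_eq_iff)
  moreover have "scalar_quat (2 * qdot (P * q * quat_k) (D * q)) = scalar_quat (h * f * plane_scalar u)"
    unfolding qdot_k_eq[symmetric] tr right_diff_distrib[symmetric] PD by (simp add: quat_eq_iff)
  then have "2 * qdot (P * q * quat_k) (D * q) = h * f * plane_scalar u"
    by (simp add: quat_eq_iff)
  ultimately show ?thesis by (intro exI[of _ "Dual (P * q) (D * q)"]) (simp add: solves_system_iff)
qed

text \<open>Write P = r R with R primitive: up to a unit the content of \<open>qrot P\<close> is r^2
  times that of \<open>qrot R\<close>, and the latter has no real zeros.\<close>

lemma solves_system_even_order:
  assumes C: "solves_system u h C" and u: "plane_vec u \<noteq> 0"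
  shows "h \<noteq> 0" "even (order x (h * realgcd (plane_vec u)))"
proof -
  define P where "P = primal_part C"
  have P: "P \<noteq> 0" "qrot P = scalar_quat h * plane_vec u"
    using C by (auto simp: solves_system_iff P_def)
  have "qrot P \<noteq> 0" using P(1) by simp
  then show "h \<noteq> 0" using P(2) by (auto simp: quat_eq_iff)
  obtain R where R: "P = scalar_quat (realgcd P) * R" "realgcd R = 1" using realgcd_factor P(1) by blast
  then have "R \<noteq> 0" by auto
  have "normalize (h * realgcd (plane_vec u)) = realgcd (qrot P)" by (simp add: P(2) realgcd_mult)
  also have "\<dots> = normalize ((realgcd P)\<^sup>2 * realgcd (qrot R))"
    by (metis R(1) qrot_scalar_mult realgcd_mult)
  finally have "order x (h * realgcd (plane_vec u)) = order x ((realgcd P)\<^sup>2 * realgcd (qrot R))"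
    by (metis order_normalize)
  also have "\<dots> = order x (realgcd P) + order x (realgcd P) + order x (realgcd (qrot R))"
    using P(1) \<open>R \<noteq> 0\<close> by (simp add: order_mult power2_eq_square)
  also have "order x (realgcd (qrot R)) = 0"
    using poly_realgcd_qrot[OF R(2)] order_root by blast
  finally show "even (order x (h * realgcd (plane_vec u)))" by simp
qed

text \<open>
  With \<open>P = r R\<close> and \<open>R\<close> primitive, the content \<open>m\<close> of \<open>R k R\<^sup>*\<close> divides \<open>N(R)\<close>, so
  \<open>qrot_mult_qnorm_mult\<close> shows that \<open>m\<close> divides \<open>\<langle>R k, D\<rangle>\<close>. As \<open>r\<^sup>2 m\<close> is associated to \<open>h g\<close>, where \<open>g\<close>
  is the content of the primal part of \<open>u\<close>, the second equation gives \<open>g dvd r u\<^sub>0\<close>, then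
  \<open>g dvd r l\<close> for \<open>l = gcd(g, u\<^sub>0)\<close>, and \<open>g\<^sup>2 m dvd l\<^sup>2 r\<^sup>2 m\<close> can be divided by \<open>g\<close>.
\<close>
lemma solves_system_dvd:
  assumes C: "solves_system u h C" and u: "plane_vec u \<noteq> 0"
  shows "realgcd (plane_vec u) dvd (gcd (realgcd (plane_vec u)) (plane_scalar u))\<^sup>2 * h"
proof -
  define g where "g = realgcd (plane_vec u)"
  define l where "l = gcd g (plane_scalar u)"
  obtain P D where PD: "C = Dual P D" by (cases C)
  have P: "P \<noteq> 0" "qdot P D = 0" "qrot P = scalar_quat h * plane_vec u"
      "2 * qdot (P * quat_k) D = h * plane_scalar u"
    using C by (auto simp: solves_system_iff PD)
  define r where "r = realgcd P"
  obtain R where R: "P = scalar_quat r * R" "realgcd R = 1" using realgcd_factor P(1) r_def by blast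
  define m where "m = realgcd (qrot R)"
  have r0: "r \<noteq> 0" using P(1) by (simp add: r_def)
  have h0: "h \<noteq> 0" and g0: "g \<noteq> 0"
    using solves_system_even_order(1)[OF C u] u by (simp_all add: g_def)
  have "normalize (h * g) = realgcd (qrot P)" by (simp add: P(3) realgcd_mult g_def)
  also have "\<dots> = normalize (r\<^sup>2 * m)"
    by (simp add: R(1) qrot_scalar_mult realgcd_mult m_def)
  finally have hg: "normalize (h * g) = normalize (r\<^sup>2 * m)" .
  then have m0: "m \<noteq> 0" using h0 g0 by auto
  define z where "z = qdot (R * quat_k) D"
  have "qdot R D = 0" using P(2) r0 by (simp add: R(1) qdot_scalar_left)
  then have eq: "qrot R * D + scalar_quat (qnorm R) * (D * quat_k) = scalar_quat (- 2 * z) * R"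
    unfolding z_def by (rule qrot_mult_qnorm_mult)
  have "m dvd qnorm R" unfolding m_def by (rule realgcd_qrot_dvd_qnorm)
  moreover have "m dvd Qi (qrot R)" "m dvd Qj (qrot R)" "m dvd Qk (qrot R)"
    using dvd_realgcd_iff[of m "qrot R"] by (simp_all add: m_def)
  ultimately have "m dvd realgcd (qrot R * D + scalar_quat (qnorm R) * (D * quat_k))"
    by (simp add: dvd_realgcd_iff quat_mult_sel qrot_sel(1) dvd_diff dvd_add)
  then have "m dvd normalize (- 2 * z * realgcd R)" unfolding eq realgcd_mult .
  then have "m dvd 2 * z" by (simp add: R(2))
  moreover have "h * plane_scalar u = r * (2 * z)"
    using P(4) by (simp add: R(1) z_def mult.assoc qdot_scalar_left)
  ultimately have "r * m dvd h * plane_scalar u" by simp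
  then have "r * (r * m) dvd r * (h * plane_scalar u)" by (rule mult_dvd_mono[OF dvd_refl])
  then have "r\<^sup>2 * m dvd h * (r * plane_scalar u)" by (simp only: power2_eq_square ac_simps)
  moreover have hg': "h * g dvd r\<^sup>2 * m" "r\<^sup>2 * m dvd h * g"
    using associatedD1[OF hg] associatedD2[OF hg] by simp_all
  ultimately have "h * g dvd h * (r * plane_scalar u)" by (metis dvd_trans)
  then have "g dvd r * plane_scalar u" using h0 by simp
  then have "g dvd gcd (r * g) (r * plane_scalar u)" by simp
  then have "g dvd normalize (r * l)" by (simp only: l_def gcd_mult_left)
  then have "g dvd r * l" by simp
  then have "g * g * m dvd r * l * (r * l) * m" by (intro mult_dvd_mono) auto
  also have "\<dots> = l\<^sup>2 * (r\<^sup>2 * m)" by (simp add: power2_eq_square)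
  also have "\<dots> dvd l\<^sup>2 * (h * g)" using hg'(2) by (rule mult_dvd_mono[OF dvd_refl])
  finally have "g * (g * m) dvd g * (l\<^sup>2 * h)" by (simp add: mult_ac)
  then have "g * m dvd l\<^sup>2 * h" using g0 by simp
  then show ?thesis unfolding g_def[symmetric] l_def[symmetric] by (rule dvd_mult_left)
qed

section \<open>Construction of the dual part of a solution\<close>

lemma realgcd_bezout: "\<exists>y. qdot x y = realgcd x"
proof -
  have bez: "\<exists>c d. c * a + d * b = gcd a b" for a b :: "real poly"
    using bezout_coefficients_fst_snd by blast
  define k where "k = gcd (Qj x) (Qk x)"
  define r where "r = gcd (Qi x) k"
  obtain c d where k: "c * Qj x + d * Qk x = k" using bez unfolding k_def by blast
  obtain e f where r: "e * Qi x + f * k = r" using bez unfolding r_def by blast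
  obtain a b where g: "a * Qre x + b * r = gcd (Qre x) r" using bez by blast
  have "realgcd x = gcd (Qre x) r"
    by (simp add: realgcd_def q_coeffs_def k_def r_def)
  also have "\<dots> = qdot x (Quat a (b * e) (b * f * c) (b * f * d))"
    unfolding g[symmetric] unfolding r[symmetric] unfolding k[symmetric] by (simp add: qdot_def algebra_simps)
  finally show ?thesis by metis
qed

text \<open>
  A particular solution is \<open>D = A P\<close> with \<open>\<langle>P k P\<^sup>*, A\<rangle> = e\<close>. The solutions of the homogeneous equations
  include the multiples of \<open>P i\<close> and \<open>P j\<close>, which change the \<open>i\<close>- and \<open>j\<close>-components of \<open>P\<^sup>* D\<close> by
  multiples of \<open>N(P)\<close>; these components are reduced modulo \<open>N(P)\<close>.
\<close>
lemma dual_part_exists: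
  assumes "realgcd (qrot P) = 1" "P \<noteq> 0"
  shows "\<exists>D. qdot P D = 0 \<and> qdot (P * quat_k) D = e \<and>
    qdeg D + qdeg P \<le> max (2 * qdeg P) (degree e)"
proof -
  obtain y where y: "qdot (qrot P) y = 1" using realgcd_bezout assms(1) by metis
  \<comment> \<open>Dropping the real part of y does not affect the inner product with
    \<open>qrot P\<close>, whose real part is zero, and makes A P orthogonal to P.\<close>
  define A where "A = Quat 0 (e * Qi y) (e * Qj y) (e * Qk y)"
  have A: "Qre A = 0" "qdot (qrot P) A = e"
    using y by (simp_all add: A_def qdot_def qrot_sel(1) algebra_simps flip: distrib_left)
  define E where "E = qconj P * (A * P)"
  define a b where "a = Qi E div qnorm P" and "b = Qj E div qnorm P"
  define D where "D = A * P - P * Quat 0 a b 0"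
  have "qconj P * P = scalar_quat (qnorm P)" using mult_qconj[of "qconj P"] 
    by (simp add: quat_eq_iff quat_mult_sel qnorm_def power2_eq_square)
  then have PD: "qconj P * D = E - scalar_quat (qnorm P) * Quat 0 a b 0"
    by (simp add: D_def E_def right_diff_distrib flip: mult.assoc)
  have E: "Qre E = 0" "Qk E = e"
    by (simp_all add: E_def A qdot_mult_self qdot_qrot flip: qdot_eq_Qre qdot_k_eq_Qk)
  have c: "Qre (qconj P * D) = 0" "Qi (qconj P * D) = Qi E mod qnorm P"
      "Qj (qconj P * D) = Qj E mod qnorm P" "Qk (qconj P * D) = e"
    by (simp_all add: PD E a_def b_def minus_mult_div_eq_mod)
  have "degree (p mod qnorm P) \<le> 2 * qdeg P" for p
    using degree_mod_less[of "qnorm P" p] assms(2) by (auto simp: degree_qnorm)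
  then have "qdeg (qconj P * D) \<le> max (2 * qdeg P) (degree e)"
    unfolding qdeg_le_iff c by (auto intro: max.coboundedI1)
  moreover have "qdeg D + qdeg P = qdeg (qconj P * D)" if "D \<noteq> 0"
    using that assms(2) qdeg_mult[of "qconj P" D] by (simp add: quat_eq_iff)
  moreover have "qdeg D = 0" if "D = 0" using that by (simp add: qdeg_def q_coeffs_def)
  ultimately have "qdeg D + qdeg P \<le> max (2 * qdeg P) (degree e)" by (cases "D = 0") auto
  moreover have "qdot P D = 0" "qdot (P * quat_k) D = e" using c by (simp_all add: qdot_eq_Qre[of P] qdot_k_eq_Qk)
  ultimately show ?thesis by blast
qed


section \<open>Minimally saturated plane polynomials\<close>

lemma dq_realgcd_plane:
  "plane_polynomial u \<Longrightarrow> dq_realgcd u = gcd (realgcd (plane_vec u)) (plane_scalar u)"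
  by (auto simp: plane_polynomial_def dq_realgcd_def realgcd_def dq_coeffs_def q_coeffs_def
      scalar_quat_def ac_simps)

lemma scalar_dq_mult: "scalar_dq (a * b) = scalar_dq a * scalar_dq b"
  by (simp add: scalar_dq_def times_dual_def scalar_quat_mult)

lemma plane_vec_scalar_dq [simp]: "plane_vec (scalar_dq f * u) = scalar_quat f * plane_vec u"
  by (simp add: scalar_dq_def times_dual_def)

text \<open>Dividing u by a factor with real zeros of even order only would leave it saturated,
  against minimality.\<close>

lemma minimally_saturated_odd_order:
  assumes u: "minimally_saturated u" "u = scalar_dq l * v" and l: "l \<noteq> 0"
    and f: "f dvd l" "degree f > 0"
  shows "\<exists>x. odd (order x f)"
proof (rule ccontr)
  assume even: "\<not> ?thesis"
  obtain e where e: "l = f * e" using f by blast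
  have sat: "saturated (scalar_dq l * v)" using u by (simp add: minimally_saturated_def)
  have "even (order x e + order x (realgcd (plane_vec v)))" for x
  proof -
    have "even (order x (f * e) + order x (realgcd (plane_vec v)))"
      using sat l by (simp add: saturated_mult e)
    moreover have "order x (f * e) = order x f + order x e" using l e by (simp add: order_mult)
    ultimately show ?thesis using even by simp
  qed
  then have "saturated (scalar_dq e * v)" using sat l by (simp add: saturated_mult e)
  moreover have "u = scalar_dq f * (scalar_dq e * v)"
    by (simp only: u(2) e scalar_dq_mult mult.assoc)
  ultimately show False using u(1) f(2) unfolding minimally_saturated_def by blast
qed

text \<open>A multiple real zero or a non-real zero of l would give a factor with even orders only.
  So all zeros of l are real and simple, and the content of \<open>plane_vec u\<close>, being of
  even order there, vanishes at least twice.\<close>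

lemma minimally_saturated_power2_dvd:
  assumes u: "minimally_saturated u" "u = scalar_dq l * v" and l: "l \<noteq> 0" "l dvd realgcd (plane_vec u)"
  shows "l\<^sup>2 dvd realgcd (plane_vec u)"
proof -
  define g where "g = realgcd (plane_vec u)"
  have g: "g \<noteq> 0" "even (order x g)" for x
    using u(1) by (auto simp: minimally_saturated_def saturated_iff_order g_def)
  define d where "d = gcd (l\<^sup>2) g"
  \<comment> \<open>This p collects what the square of l has beyond g; it turns out to have no
    complex zero.\<close>
  obtain p where p: "l\<^sup>2 = d * p" unfolding d_def by (metis dvdE gcd_dvd1)
  have nz: "d \<noteq> 0" "p \<noteq> 0" "l\<^sup>2 \<noteq> 0" using l p by auto
  have ord: "order a p = 0" for a
  proof -
    have "order a l \<le> 1"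
    proof (rule ccontr)
      assume "\<not> ?thesis"
      then have "[:- a, 1:]\<^sup>2 dvd l" using l(1) by (subst order_divides) simp
      moreover have "degree ([:- a, 1:]\<^sup>2) > 0" by (simp add: degree_power_eq)
      ultimately obtain x where "odd (order x ([:- a, 1:]\<^sup>2))"
        using minimally_saturated_odd_order[OF u l(1)] by blast
      moreover have "order x ([:- a, 1:]\<^sup>2) = order x [:- a, 1:] + order x [:- a, 1:]"
        unfolding power2_eq_square by (rule order_mult) simp
      ultimately show False by simp
    qed
    moreover have "order a l \<le> order a g" using l(2) g(1) by (simp add: dvd_imp_order_le g_def)
    ultimately have "2 * order a l \<le> order a g" using g(2)[of a]
      by (cases "order a l = 0") (auto elim!: evenE)
    moreover have "order a (l\<^sup>2) = 2 * order a l"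
      using l(1) by (simp add: power2_eq_square order_mult)
    ultimately have "order a d = order a (l\<^sup>2)"
      using nz g(1) by (simp add: d_def order_gcd)
    moreover have "order a (l\<^sup>2) = order a d + order a p" using nz unfolding p by (simp add: order_mult)
    ultimately show ?thesis by simp
  qed
  have "degree p = 0"
  proof (rule ccontr)
    assume "degree p \<noteq> 0"
    then have "degree p > 0" by simp
    then show False
    proof (cases rule: real_poly_factor_cases)
      case (1 a)
      then show False using ord[of a] nz by (simp add: order_root poly_eq_0_iff_dvd[symmetric])
    next
      case (2 z)
      then have "cquad z dvd l\<^sup>2" by (simp add: p)
      then have "cquad z dvd l" using 2 by (simp add: cquad_dvd_iff power2_eq_square)
      then show False using minimally_saturated_odd_order[OF u l(1), of "cquad z"] 2 by auto
    qed
  qed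
  then have "p dvd 1" using nz by (simp add: is_unit_iff_degree)
  then have "l\<^sup>2 dvd d" unfolding p by simp
  then show ?thesis unfolding d_def g_def[symmetric] by simp
qed

lemma kinematic_qnorm:
  assumes "kinematic u"
  obtains s where "qnorm (plane_vec u) = s\<^sup>2"
proof -
  obtain s where "dq_norm u = scalar_dq (s\<^sup>2)" using assms by (auto simp: kinematic_def)
  then have "scalar_quat (qnorm (plane_vec u)) = scalar_quat (s\<^sup>2)"
    by (simp add: dq_norm_def dq_conj_def times_dual_def scalar_dq_def mult_qconj)
  then show ?thesis using that by (simp add: quat_eq_iff)
qed

text \<open>If \<open>qrot P\<close> is the primitive part w of \<open>plane_vec u\<close>, then Q =
  l h P solves the first equation because (l h)^2 w = h (l^2 h) w.\<close>

lemma solves_system_exists: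
  assumes u: "kinematic u" "plane_vec u \<noteq> 0" and deg: "degree (plane_scalar u) \<le> qdeg (plane_vec u)"
    and l: "l dvd plane_scalar u" "realgcd (plane_vec u) = l\<^sup>2 * h"
  shows "\<exists>C. solves_system u h C \<and> 2 * dq_degree C \<le> degree h + qdeg (plane_vec u)"
proof -
  define g where "g = realgcd (plane_vec u)"
  have g0: "g \<noteq> 0" using u(2) by (simp add: g_def)
  have lh0: "l \<noteq> 0" "h \<noteq> 0" using g0 l(2) by (auto simp: g_def)
  obtain w where w: "plane_vec u = scalar_quat g * w" "realgcd w = 1"
    using realgcd_factor[OF u(2)] unfolding g_def by blast
  have "Qre (plane_vec u) = 0" using u(1) by (auto simp: kinematic_def plane_polynomial_def)
  then have "Qre w = 0" using g0 by (simp add: w)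
  obtain s where s: "qnorm (plane_vec u) = s\<^sup>2" using kinematic_qnorm[OF u(1)] by blast
  then have gs: "g\<^sup>2 * qnorm w = s\<^sup>2" by (simp add: w(1) qnorm_mult)
  then have "g\<^sup>2 dvd s\<^sup>2" by (metis dvd_triv_left)
  then obtain t where "s = g * t" by auto
  then have "qnorm w = t\<^sup>2" using gs g0 by (simp add: power_mult_distrib)
  then obtain P where P: "qrot P = w"
    using primitive_vector_eq_qrot w(2) \<open>Qre w = 0\<close> by blast
  have P0: "P \<noteq> 0" using P w(2) by (auto simp: quat_eq_iff qrot_sel realgcd_def q_coeffs_def)
  obtain e where e: "plane_scalar u = l * e" using l(1) by blast
  \<comment> \<open>After division by 2 l h the second equation for Q asks for e / 2 here.\<close>
  obtain D where D: "qdot P D = 0" "qdot (P * quat_k) D = smult (1 / 2) e"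
      "qdeg D + qdeg P \<le> max (2 * qdeg P) (degree (smult (1 / 2) e))"
    using dual_part_exists P0 P w(2) by metis
  define Q where "Q = scalar_quat (l * h) * P"
  have Q0: "Q \<noteq> 0" using P0 lh0 by (simp add: Q_def quat_eq_iff)
  have Q: "qrot Q = scalar_quat h * plane_vec u"
  proof -
    have "g = l\<^sup>2 * h" using l(2) by (simp only: g_def)
    then have "(l * h)\<^sup>2 = h * g" by (simp only: power2_eq_square ac_simps)
    then have "qrot Q = scalar_quat (h * g) * w" by (simp only: Q_def qrot_scalar_mult P)
    then show ?thesis by (simp only: w(1) scalar_quat_mult mult.assoc)
  qed
  have "2 * qdot (Q * quat_k) D = 2 * (l * h) * smult (1 / 2) e"
    by (simp add: Q_def mult.assoc qdot_scalar_left D)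
  also have "\<dots> = h * plane_scalar u" by (simp add: e numeral_poly)
  finally have "solves_system u h (Dual Q D)"
    using Q0 Q D(1) by (simp add: solves_system_iff Q_def qdot_scalar_left)
  moreover have "2 * dq_degree (Dual Q D) \<le> degree h + qdeg (plane_vec u)"
  proof -
    have dQ: "2 * qdeg Q = degree h + qdeg (plane_vec u)"
      using qdeg_qrot[of Q] lh0 u(2) by (simp add: Q qdeg_scalar_mult)
    have dQP: "qdeg Q = degree l + degree h + qdeg P"
      using lh0 P0 by (simp add: Q_def qdeg_scalar_mult degree_mult_eq)
    \<comment> \<open>The degree bound on the scalar part of u enters here and keeps the degree of D
      at most that of Q.\<close>
    have "degree e \<le> qdeg Q + qdeg P"
    proof (cases "e = 0")
      case False
      then have "degree (plane_scalar u) = degree l + degree e" using lh0 by (simp add: e degree_mult_eq)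
      then show ?thesis using dQ dQP deg by simp
    qed simp
    then have "qdeg D \<le> qdeg Q" using D(3) dQP by (simp add: max_def split: if_splits)
    then show ?thesis using dQ by (simp add: dq_degree_eq)
  qed
  ultimately show ?thesis by blast
qed

theorem proposition3:
  fixes u v :: dhpoly and l h :: "real poly"
  assumes "kinematic u"
    and "minimally_saturated u"
    and "equal_degrees u"
    and "reduced_representative u v"
    and "saturating_factor v l"
  shows "((\<exists>C. solves_system u h C) \<longleftrightarrow>
      realgcd (scalar_quat l * plane_vec v) div l\<^sup>2 dvd h \<and> saturated (scalar_dq (h * l) * v)) \<and>
    (\<exists>C. solves_system u (realgcd (scalar_quat l * plane_vec v) div l\<^sup>2) C \<and>
      (\<forall>h' C'. solves_system u h' C' \<longrightarrow> dq_degree C \<le> dq_degree C'))"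
proof -
  define g where "g = realgcd (plane_vec u)"
  have plane: "plane_polynomial u" using assms(1) by (simp add: kinematic_def)
  have g: "g \<noteq> 0" "even (order x g)" for x
    using assms(2) by (auto simp: minimally_saturated_def saturated_iff_order g_def)
  then have u0: "plane_vec u \<noteq> 0" by (auto simp: g_def)
  \<comment> \<open>The saturating factor of the reduced representative is the content of u.\<close>
  have l: "l = gcd g (plane_scalar u)"
    using saturating_factor_reduced[OF assms(2,4)] assms(5) dq_realgcd_plane[OF plane]
    by (simp add: g_def)
  then have l0: "l \<noteq> 0" using g by auto
  have uv: "u = scalar_dq l * v"
    using assms(4) saturating_factor_reduced[OF assms(2,4)] assms(5)
    by (simp add: reduced_representative_def)
  then have vec: "scalar_quat l * plane_vec v = plane_vec u" by (metis plane_vec_scalar_dq)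
  have huv: "scalar_dq (h * l) * v = scalar_dq h * u"
    by (simp only: uv scalar_dq_mult mult.assoc)
  define h0 where "h0 = g div l\<^sup>2"
  have "l\<^sup>2 dvd g"
    using minimally_saturated_power2_dvd[OF assms(2) uv l0] by (simp add: g_def[symmetric] l)
  then have gh0: "g = l\<^sup>2 * h0" by (simp add: h0_def)
  then have h00: "h0 \<noteq> 0" using g by auto
  \<comment> \<open>The content g has even orders already, so only the real zeros of h
    matter.\<close>
  have sat: "saturated (scalar_dq h * u) \<longleftrightarrow> h \<noteq> 0 \<and> (\<forall>x. even (order x h))"
  proof (cases "h = 0")
    case True
    then show ?thesis by (auto simp: saturated_def quat_eq_iff)
  next
    case False
    then show ?thesis using plane g u0 by (simp add: saturated_mult flip: g_def)
  qed
  have "degree (plane_scalar u) \<le> qdeg (plane_vec u)"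
    using assms(3) qdeg_le_iff[of "plane_vec u" "qdeg (plane_vec u)"] by (simp add: equal_degrees_def)
  moreover have "l dvd plane_scalar u" by (simp add: l)
  moreover have "realgcd (plane_vec u) = l\<^sup>2 * h0" using gh0 by (simp only: g_def)
  ultimately obtain C
    where C: "solves_system u h0 C" "2 * dq_degree C \<le> degree h0 + qdeg (plane_vec u)"
    using solves_system_exists[OF assms(1) u0] by blast
  have dvd: "h0 dvd h'" if "solves_system u h' C'" for h' C'
  proof -
    have "g dvd l\<^sup>2 * h'" using solves_system_dvd[OF that u0] by (simp add: l g_def)
    then show ?thesis using l0 by (simp add: gh0)
  qed
  \<comment> \<open>The first equation fixes the degree of the primal part in terms of h', and
    \<open>h0\<close> divides h'; C stays within the resulting bound.\<close>
  have "dq_degree C \<le> dq_degree C'" if C': "solves_system u h' C'" for h' C'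
  proof -
    have h': "h' \<noteq> 0" using solves_system_even_order(1)[OF C' u0] .
    have "qrot (primal_part C') = scalar_quat h' * plane_vec u" using C' by (simp add: solves_system_iff)
    then have "2 * qdeg (primal_part C') = degree h' + qdeg (plane_vec u)"
      using qdeg_qrot[of "primal_part C'"] h' u0 by (simp add: qdeg_scalar_mult)
    moreover have "degree h0 \<le> degree h'" using dvd[OF C'] h' by (rule dvd_imp_degree_le)
    moreover have "qdeg (primal_part C') \<le> dq_degree C'" by (simp add: dq_degree_eq)
    ultimately show ?thesis using C(2) by linarith
  qed
  moreover have "(\<exists>C. solves_system u h C) \<longleftrightarrow> h0 dvd h \<and> saturated (scalar_dq h * u)"
  proof (intro iffI; elim exE conjE)
    fix C assume C: "solves_system u h C"
    have "h \<noteq> 0" using solves_system_even_order(1)[OF C u0] .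
    moreover have "even (order x h)" for x
      using solves_system_even_order(2)[OF C u0, of x] g(2)[of x] g(1) \<open>h \<noteq> 0\<close>
      by (simp add: order_mult flip: g_def)
    ultimately show "h0 dvd h \<and> saturated (scalar_dq h * u)" using dvd[OF C] sat by blast
  next
    assume "h0 dvd h" and "saturated (scalar_dq h * u)"
    then obtain f where f: "h = h0 * f" and h: "h \<noteq> 0" "\<And>x. even (order x h)" using sat by blast
    \<comment> \<open>As g = l^2 h0 has even orders, so have \<open>h0\<close> and the quotient f of
      h by it.\<close>
    have "even (order x f)" for x
    proof -
      have "order x g = order x l + order x l + order x h0"
        using l0 h00 by (simp add: gh0 order_mult power2_eq_square)
      then have "even (order x h0)" using g(2)[of x] by simp
      moreover have "order x h = order x h0 + order x f" using h(1) by (simp add: f order_mult)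
      ultimately show ?thesis using h(2)[of x] by simp
    qed
    moreover have "f \<noteq> 0" using f h(1) by auto
    ultimately obtain q where "qrot q = scalar_quat f * quat_k" using even_order_qrot by blast
    then show "\<exists>C. solves_system u h C" using solves_system_mult C(1) \<open>f \<noteq> 0\<close> unfolding f by blast
  qed
  ultimately show ?thesis
    unfolding vec huv g_def[symmetric] h0_def[symmetric] using C(1) by blast
qed

end
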